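(* Consider the extreme shock model with possibly increasing threshold described in the context, with $\alpha_{k,l}=\alpha+b_k-c_l$ and $\bar F(\beta)>0$. Then for all integers $k\ge0$ and $l\ge0$, $$P\{N_+(\nu)=k,\,N_-(\nu)=l\}=\left[1-\frac{\bar F(\beta)}{\bar F(\gamma)}\right]^k\ \prod_{h=0}^{l-1}\left\{1-\frac{\bar F(\alpha_{k,h})}{\bar F(\beta)}\right\}\ \frac{\bar F(\alpha_{k,l})}{\bar F(\gamma)},$$ where the empty product (case $l=0$) equals $1$.
   Context: Let $X_1,X_2,\dots$ be i.i.d. real random variables (shock magnitudes), with $F(x)=P\{X_1<x\}$ and $\bar F(x)=1-F(x)=P\{X_1\ge x\}$; $0^0=1$. Let $\gamma\le\beta\le\alpha$ be real numbers, and let $(b_k)_{k\ge0}$, $(c_l)_{l\ge0}$ be real sequences, $b_0=c_0=0$, $b_1>0$, both nondecreasing, such that $\alpha_{k,l}:=\alpha+b_k-c_l\ge\beta$ for all $k,l\ge0$. Define recursively $N_-(0)=N_+(0)=0$ and, for $n\ge1$, the number of weakening shocks before the $n$-th shock $$N_-(n)=\sum_{1\le i<n}1\{X_i\in[\beta,\ \alpha+b_{N_+(i)}-c_{N_-(i)})\},$$ and the number of strengthening shocks before the $n$-th shock (and before the first weakening shock) $$N_+(n)=\sum_{1\le i<n}1\{X_i\in[\gamma,\beta),\ N_-(i)=0\}.$$ The index of the first fatal shock is $\nu=\min\{i\ge1:X_i\ge\alpha+b_{N_+(i)}-c_{N_-(i)}\}$ (with value $\infty$ if the set is empty). Events involving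 $N_\pm(\nu)$ are understood to be intersected with $\{\nu<\infty\}$. *)

theory Defs
  imports "HOL-Probability.Probability"
begin

text \<open>\<open>F x = P(X < x)\<close> with strict inequality, unlike the library's \<^const>\<open>cdf\<close>.\<close>

definition strict_cdf :: "'a measure \<Rightarrow> ('a \<Rightarrow> real) \<Rightarrow> real \<Rightarrow> real" where
  "strict_cdf M Y x = measure M {\<omega> \<in> space M. Y \<omega> < x}"

definition tail_prob :: "'a measure \<Rightarrow> ('a \<Rightarrow> real) \<Rightarrow> real \<Rightarrow> real" where
  "tail_prob M Y x = 1 - strict_cdf M Y x"

definition threshold :: "real \<Rightarrow> (nat \<Rightarrow> real) \<Rightarrow> (nat \<Rightarrow> real) \<Rightarrow> nat \<Rightarrow> nat \<Rightarrow> real" where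
  "threshold \<alpha> b c k l = \<alpha> + b k - c l"

text \<open>
  The following notions are defined for a single path \<open>x\<close> of shock magnitudes.  Shocks are
  numbered from 1, so \<open>x 0\<close> is never inspected; the values at \<open>n = 0\<close> and \<open>n = 1\<close> are empty sums.
\<close>

function N_minus :: "real \<Rightarrow> real \<Rightarrow> real \<Rightarrow> (nat \<Rightarrow> real) \<Rightarrow> (nat \<Rightarrow> real) \<Rightarrow> (nat \<Rightarrow> real) \<Rightarrow> nat \<Rightarrow> nat"
  and N_plus :: "real \<Rightarrow> real \<Rightarrow> real \<Rightarrow> (nat \<Rightarrow> real) \<Rightarrow> (nat \<Rightarrow> real) \<Rightarrow> (nat \<Rightarrow> real) \<Rightarrow> nat \<Rightarrow> nat"
where
  "N_minus \<gamma> \<beta> \<alpha> b c x n =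
     (\<Sum>i\<in>{1..<n}. of_bool (x i \<in> {\<beta> ..<
        threshold \<alpha> b c (N_plus \<gamma> \<beta> \<alpha> b c x i) (N_minus \<gamma> \<beta> \<alpha> b c x i)}))"
| "N_plus \<gamma> \<beta> \<alpha> b c x n =
     (\<Sum>i\<in>{1..<n}. of_bool (x i \<in> {\<gamma> ..< \<beta>} \<and> N_minus \<gamma> \<beta> \<alpha> b c x i = 0))"
  by pat_completeness auto
termination
  by (relation "Wellfounded.measure (case_sum (\<lambda>(_, _, _, _, _, _, n). n) (\<lambda>(_, _, _, _, _, _, n). n))")
     auto

declare N_minus.simps [simp del] N_plus.simps [simp del]

text \<open>In \<^typ>\<open>enat\<close>, the infimum of the empty set is \<open>\<infinity>\<close>.\<close>

definition fatal_index ::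
  "real \<Rightarrow> real \<Rightarrow> real \<Rightarrow> (nat \<Rightarrow> real) \<Rightarrow> (nat \<Rightarrow> real) \<Rightarrow> (nat \<Rightarrow> real) \<Rightarrow> enat" where
  "fatal_index \<gamma> \<beta> \<alpha> b c x =
     Inf (enat ` {i. 1 \<le> i \<and>
       x i \<ge> threshold \<alpha> b c (N_plus \<gamma> \<beta> \<alpha> b c x i) (N_minus \<gamma> \<beta> \<alpha> b c x i)})"

end

(*
The system is a Markov chain on the states (k,l). Let a_n(k,l) be the probability that the first
n shocks are not fatal and lead to the state (k,l). The next shock is independent of this event,
so a_(n+1) is a linear expression in a_n, and summing over n gives a recursion in (k,l) for the
expected number of visits S(k,l). With T the tail function, S(0,0) = 1 / T gamma and
  S(k+1,0) = (T gamma - T beta) / T gamma * S(k,0),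
  S(k,l+1) = (T beta - T alpha_(k,l)) / T beta * S(k,l),
because a state with l = 0 is left exactly when a shock is at least gamma, and a state with l > 0
exactly when a shock is at least beta. The required probability is
S(k,l) * T alpha_(k,l).
*)

theory Submission
  imports Defs
begin

text \<open>Summing a recursion in time gives an equation for the series. In the application
  \<open>u n\<close> is the probability of being in a state, \<open>v n\<close> the inflow from its
  predecessor and \<open>1 - q\<close> the probability of leaving, whose positivity forces
  convergence.\<close>

lemma recurrence_sums:
  fixes u v :: "nat \<Rightarrow> real"
  assumes u: "\<And>n. u n \<ge> 0" and v: "\<And>n. v n \<ge> 0" and q: "q < 1"
    and rec: "\<And>n. u (Suc n) = q * u n + v n" and V: "v sums V"
  shows "u sums ((u 0 + V) / (1 - q))"
proof -
  \<comment> \<open>The recursion telescopes on partial sums, so summability of \<open>u\<close> is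
    not presupposed.\<close>
  have sum_eq: "(1 - q) * (\<Sum>i<n. u i) = u 0 - u n + (\<Sum>i<n. v i)" for n
  proof (induction n)
    case (Suc n)
    have "(1 - q) * (\<Sum>i<Suc n. u i) = (1 - q) * (\<Sum>i<n. u i) + (1 - q) * u n"
      by (simp add: distrib_left)
    also have "\<dots> = u 0 - u (Suc n) + (\<Sum>i<Suc n. v i)"
      unfolding Suc.IH by (simp add: rec left_diff_distrib)
    finally show ?case .
  qed simp
  have "(\<Sum>i<n. u i) \<le> (u 0 + V) / (1 - q)" for n
  proof -
    have "(\<Sum>i<n. v i) \<le> V"
      using sum_le_suminf[OF sums_summable[OF V], of "{..<n}"] v V by (auto simp: sums_iff)
    then have "(1 - q) * (\<Sum>i<n. u i) \<le> u 0 + V"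
      using sum_eq[of n] u[of n] by linarith
    then show ?thesis
      using q by (simp add: pos_le_divide_eq mult.commute)
  qed
  then have "summable u"
    using u by (intro summableI_nonneg_bounded) auto
  then have "u \<longlonglongrightarrow> 0"
    by (rule summable_LIMSEQ_zero)
  then have "(\<lambda>n. (u 0 - u n + (\<Sum>i<n. v i)) / (1 - q)) \<longlonglongrightarrow> (u 0 - 0 + V) / (1 - q)"
    using V q unfolding sums_def by (intro tendsto_intros) auto
  moreover have "(u 0 - u n + (\<Sum>i<n. v i)) / (1 - q) = (\<Sum>i<n. u i)" for n
    using sum_eq[of n] q by (simp add: field_simps)
  ultimately show ?thesis
    unfolding sums_def by simp
qed

section \<open>Transitions of the state along a single path\<close>

context
  fixes \<gamma> \<beta> \<alpha> :: real and b c :: "nat \<Rightarrow> real"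
begin

abbreviation (input) "Nm \<equiv> N_minus \<gamma> \<beta> \<alpha> b c"
abbreviation (input) "Np \<equiv> N_plus \<gamma> \<beta> \<alpha> b c"
abbreviation (input) "thr \<equiv> threshold \<alpha> b c"

text \<open>Only shocks before the \<open>n\<close>-th are inspected, so that \<open>x n\<close>
  remains free as the next, independent shock. After \<open>n\<close> shocks the relevant index is
  therefore \<open>Suc n\<close>.\<close>

definition survives :: "(nat \<Rightarrow> real) \<Rightarrow> nat \<Rightarrow> nat \<Rightarrow> nat \<Rightarrow> bool" where
  "survives x n k l \<longleftrightarrow>
     (\<forall>i\<in>{1..<n}. x i < thr (Np x i) (Nm x i)) \<and> Np x n = k \<and> Nm x n = l"

lemma N_cong:
  assumes "\<And>i. i \<in> {1..<n} \<Longrightarrow> x i = y i"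
  shows "Nm x n = Nm y n \<and> Np x n = Np y n"
  using assms
proof (induction n rule: less_induct)
  case (less n)
  have IH: "Nm x i = Nm y i \<and> Np x i = Np y i" if "i \<in> {1..<n}" for i
    using that less.prems by (intro less.IH) auto
  show ?case
    \<comment> \<open>Instantiating the equations at \<open>n\<close> unfolds only the outer counts;
      the inner ones, at a bound index, stay folded and are covered by \<open>IH\<close>.\<close>
    unfolding N_minus.simps[of _ _ _ _ _ _ n] N_plus.simps[of _ _ _ _ _ _ n]
    using IH less.prems by (auto intro!: sum.cong)
qed

lemma survives_cong:
  assumes "\<And>i. i \<in> {1..<n} \<Longrightarrow> x i = y i"
  shows "survives x n k l \<longleftrightarrow> survives y n k l"
proof -
  have "Nm x i = Nm y i \<and> Np x i = Np y i" if "i \<le> n" for i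
    using that assms by (intro N_cong) auto
  then show ?thesis
    unfolding survives_def using assms by auto
qed

text \<open>Sums start at index 1, so at \<open>n = 0\<close> the added term would wrongly count
  \<open>x 0\<close>.\<close>

lemma N_Suc:
  assumes "n \<ge> 1"
  shows "Nm x (Suc n) = Nm x n + of_bool (x n \<in> {\<beta> ..< thr (Np x n) (Nm x n)})"
    and "Np x (Suc n) = Np x n + of_bool (x n \<in> {\<gamma> ..< \<beta>} \<and> Nm x n = 0)"
proof -
  have *: "{1..<Suc n} = insert n {1..<n}" using assms by auto
  have "Nm x (Suc n) = (\<Sum>i\<in>insert n {1..<n}. of_bool (x i \<in> {\<beta> ..< thr (Np x i) (Nm x i)}))"
    unfolding *[symmetric] by (rule N_minus.simps)
  also have "\<dots> = of_bool (x n \<in> {\<beta> ..< thr (Np x n) (Nm x n)}) + Nm x n"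
    by (subst sum.insert) (simp_all only: N_minus.simps[symmetric], auto)
  finally show "Nm x (Suc n) = Nm x n + of_bool (x n \<in> {\<beta> ..< thr (Np x n) (Nm x n)})"
    by simp
  have "Np x (Suc n) = (\<Sum>i\<in>insert n {1..<n}. of_bool (x i \<in> {\<gamma> ..< \<beta>} \<and> Nm x i = 0))"
    unfolding *[symmetric] by (rule N_plus.simps)
  also have "\<dots> = of_bool (x n \<in> {\<gamma> ..< \<beta>} \<and> Nm x n = 0) + Np x n"
    by (subst sum.insert) (simp_all only: N_plus.simps[symmetric], auto)
  finally show "Np x (Suc n) = Np x n + of_bool (x n \<in> {\<gamma> ..< \<beta>} \<and> Nm x n = 0)"
    by simp
qed

lemma survives_1: "survives x (Suc 0) k l \<longleftrightarrow> k = 0 \<and> l = 0"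
  by (auto simp: survives_def N_minus.simps[of _ _ _ _ _ _ "Suc 0"]
      N_plus.simps[of _ _ _ _ _ _ "Suc 0"])

text \<open>Since thresholds are at least \<beta>, no shock below \<beta> is fatal. While
  \<open>l = 0\<close>, only a shock below \<gamma> leaves the state unchanged; after a weakening
  shock strengthening stops, so every shock below \<beta> does. In each disjunction the two ranges
  of \<open>x n\<close> are disjoint, so probabilities will add.\<close>

lemma survives_Suc:
  assumes "n \<ge> 1" "\<gamma> \<le> \<beta>" "\<And>k l. thr k l \<ge> \<beta>"
  shows survives_Suc_0: "survives x (Suc n) 0 0 \<longleftrightarrow> survives x n 0 0 \<and> x n \<in> {..<\<gamma>}"
    and survives_Suc_plus: "survives x (Suc n) (Suc k) 0 \<longleftrightarrow>
      (survives x n (Suc k) 0 \<and> x n \<in> {..<\<gamma>}) \<or> (survives x n k 0 \<and> x n \<in> {\<gamma>..<\<beta>})"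
    and survives_Suc_minus: "survives x (Suc n) k (Suc l) \<longleftrightarrow>
      (survives x n k (Suc l) \<and> x n \<in> {..<\<beta>}) \<or> (survives x n k l \<and> x n \<in> {\<beta>..<thr k l})"
proof -
  have *: "{1..<Suc n} = insert n {1..<n}" using assms by auto
  have ball: "(\<forall>i\<in>{1..<Suc n}. Q i) \<longleftrightarrow> (\<forall>i\<in>{1..<n}. Q i) \<and> Q n" for Q
    unfolding * by auto
  show "survives x (Suc n) 0 0 \<longleftrightarrow> survives x n 0 0 \<and> x n \<in> {..<\<gamma>}"
    using assms(2) assms(3)[of "Np x n" "Nm x n"]
    unfolding survives_def ball N_Suc[OF assms(1)] by (auto split: if_splits)
  show "survives x (Suc n) (Suc k) 0 \<longleftrightarrow>
      (survives x n (Suc k) 0 \<and> x n \<in> {..<\<gamma>}) \<or> (survives x n k 0 \<and> x n \<in> {\<gamma>..<\<beta>})"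
    using assms(2) assms(3)[of "Np x n" "Nm x n"]
    unfolding survives_def ball N_Suc[OF assms(1)] by (auto split: if_splits)
  show "survives x (Suc n) k (Suc l) \<longleftrightarrow>
      (survives x n k (Suc l) \<and> x n \<in> {..<\<beta>}) \<or> (survives x n k l \<and> x n \<in> {\<beta>..<thr k l})"
    using assms(2) assms(3)[of "Np x n" "Nm x n"]
    unfolding survives_def ball N_Suc[OF assms(1)] by (auto split: if_splits)
qed

lemma fatal_index_eq_enat_iff:
  "fatal_index \<gamma> \<beta> \<alpha> b c x = enat n \<longleftrightarrow>
     1 \<le> n \<and> thr (Np x n) (Nm x n) \<le> x n \<and> (\<forall>i\<in>{1..<n}. x i < thr (Np x i) (Nm x i))"
proof -
  define S where "S = {i. 1 \<le> i \<and> thr (Np x i) (Nm x i) \<le> x i}"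
  have "Inf (enat ` S) = enat n \<longleftrightarrow> n \<in> S \<and> (\<forall>i<n. i \<notin> S)"
  proof
    assume eq: "Inf (enat ` S) = enat n"
    \<comment> \<open>A finite infimum rules out the empty set, and is then attained because it is a
      least element.\<close>
    then have "S \<noteq> {}" by (auto simp: Inf_enat_def)
    then have "Inf (enat ` S) \<in> enat ` S"
      unfolding Inf_enat_def by (auto intro: LeastI)
    moreover have "i \<notin> S" if "i < n" for i
      using that eq Inf_lower[of "enat i" "enat ` S"] by auto
    ultimately show "n \<in> S \<and> (\<forall>i<n. i \<notin> S)" using eq by auto
  next
    assume *: "n \<in> S \<and> (\<forall>i<n. i \<notin> S)"
    show "Inf (enat ` S) = enat n"
    proof (rule antisym)
      show "Inf (enat ` S) \<le> enat n" using * by (intro Inf_lower) auto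
      show "enat n \<le> Inf (enat ` S)" using * by (intro Inf_greatest) (auto simp: not_less[symmetric])
    qed
  qed
  then show ?thesis
    unfolding fatal_index_def S_def by (auto simp: not_le)
qed

text \<open>Splits the event of the theorem according to the time of the fatal shock, written
  \<open>Suc n\<close> because shocks are numbered from 1.\<close>

lemma fatal_state_iff:
  "fatal_index \<gamma> \<beta> \<alpha> b c x \<noteq> \<infinity> \<and>
     Np x (the_enat (fatal_index \<gamma> \<beta> \<alpha> b c x)) = k \<and>
     Nm x (the_enat (fatal_index \<gamma> \<beta> \<alpha> b c x)) = l \<longleftrightarrow>
   (\<exists>n. survives x (Suc n) k l \<and> x (Suc n) \<in> {thr k l..})" (is "?L \<longleftrightarrow> ?R")
proof
  assume L: ?L
  then obtain m where m: "fatal_index \<gamma> \<beta> \<alpha> b c x = enat m" by auto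
  with fatal_index_eq_enat_iff[of x m] obtain n where "m = Suc n" by (cases m) auto
  then show ?R
    using L m fatal_index_eq_enat_iff[of x m] by (auto simp: survives_def intro!: exI[of _ n])
next
  assume ?R
  then obtain n where n: "survives x (Suc n) k l" "x (Suc n) \<in> {thr k l..}" by blast
  then have "fatal_index \<gamma> \<beta> \<alpha> b c x = enat (Suc n)"
    by (subst fatal_index_eq_enat_iff) (auto simp: survives_def)
  then show ?L using n by (auto simp: survives_def)
qed

text \<open>Either pair of assumptions determines the fatal index. This makes the events of the
  splitting by time disjoint.\<close>

lemma survives_unique:
  assumes "survives x (Suc m) k l" "x (Suc m) \<in> {thr k l..}"
    and "survives x (Suc n) k l" "x (Suc n) \<in> {thr k l..}"
  shows "m = n"
proof -
  have "fatal_index \<gamma> \<beta> \<alpha> b c x = enat (Suc m)" "fatal_index \<gamma> \<beta> \<alpha> b c x = enat (Suc n)"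
    using assms by (subst fatal_index_eq_enat_iff; auto simp: survives_def)+
  then show ?thesis by simp
qed

text \<open>Strong induction: each summand involves only counts at earlier indices, and these take
  values in a discrete space, on which \<open>b\<close> and \<open>c\<close> are trivially
  measurable.\<close>

lemma measurable_N:
  assumes "\<And>i. i \<in> {1..<n} \<Longrightarrow> (\<lambda>\<omega>. f \<omega> i) \<in> borel_measurable N"
  shows "(\<lambda>\<omega>. Nm (f \<omega>) n) \<in> N \<rightarrow>\<^sub>M count_space UNIV \<and>
         (\<lambda>\<omega>. Np (f \<omega>) n) \<in> N \<rightarrow>\<^sub>M count_space UNIV"
  using assms
proof (induction n rule: less_induct)
  case (less n)
  have IH: "(\<lambda>\<omega>. Nm (f \<omega>) i) \<in> N \<rightarrow>\<^sub>M count_space UNIV"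
    "(\<lambda>\<omega>. Np (f \<omega>) i) \<in> N \<rightarrow>\<^sub>M count_space UNIV" if "i \<in> {1..<n}" for i
    using that less.prems less.IH[of i] by auto
  have summands: "(\<lambda>\<omega>. of_bool (f \<omega> i \<in> {\<beta> ..< thr (Np (f \<omega>) i) (Nm (f \<omega>) i)}) :: nat)
      \<in> N \<rightarrow>\<^sub>M count_space UNIV"
    "(\<lambda>\<omega>. of_bool (f \<omega> i \<in> {\<gamma> ..< \<beta>} \<and> Nm (f \<omega>) i = 0) :: nat)
      \<in> N \<rightarrow>\<^sub>M count_space UNIV" if "i \<in> {1..<n}" for i
  proof -
    note [measurable] = IH[OF that] less.prems[OF that]
    show "(\<lambda>\<omega>. of_bool (f \<omega> i \<in> {\<beta> ..< thr (Np (f \<omega>) i) (Nm (f \<omega>) i)}) :: nat)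
      \<in> N \<rightarrow>\<^sub>M count_space UNIV"
      unfolding threshold_def of_bool_def atLeastLessThan_iff by measurable
    show "(\<lambda>\<omega>. of_bool (f \<omega> i \<in> {\<gamma> ..< \<beta>} \<and> Nm (f \<omega>) i = 0) :: nat)
      \<in> N \<rightarrow>\<^sub>M count_space UNIV"
      unfolding of_bool_def by measurable
  qed
  show ?case
    unfolding N_minus.simps[of _ _ _ _ _ _ n] N_plus.simps[of _ _ _ _ _ _ n]
    by (intro conjI measurable_sum_nat summands)
qed

text \<open>The family \<open>f\<close> is arbitrary so that the result serves both the random path
  on the probability space and the identity on the product over \<open>{1..<n}\<close>, where only
  those coordinates are available.\<close>

lemma measurable_survives:
  assumes f: "\<And>i. i \<in> {1..<n} \<Longrightarrow> (\<lambda>\<omega>. f \<omega> i) \<in> borel_measurable N"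
  shows "Measurable.pred N (\<lambda>\<omega>. survives (f \<omega>) n k l)"
proof -
  have [measurable]: "(\<lambda>\<omega>. Nm (f \<omega>) i) \<in> N \<rightarrow>\<^sub>M count_space UNIV"
    "(\<lambda>\<omega>. Np (f \<omega>) i) \<in> N \<rightarrow>\<^sub>M count_space UNIV" if "i \<le> n" for i
    using that f measurable_N[of i f N] by auto
  have [measurable]: "Measurable.pred N (\<lambda>\<omega>. f \<omega> i < thr (Np (f \<omega>) i) (Nm (f \<omega>) i))"
    if "i \<in> {1..<n}" for i
  proof -
    have i: "i \<le> n" using that by simp
    note [measurable] = f[OF that]
    show ?thesis using i unfolding threshold_def by measurable
  qed
  show ?thesis
    unfolding survives_def by measurable
qed

end

section \<open>Law of one shock and independence from the past\<close>

context prob_space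
begin

lemma tail_prob_eq:
  assumes "Y \<in> borel_measurable M"
  shows "tail_prob M Y x = 1 - measure (distr M borel Y) {..<x}"
  using assms by (auto simp: tail_prob_def strict_cdf_def measure_distr intro!: arg_cong[of _ _ prob])

lemma measure_distr_atLeast:
  assumes Y: "Y \<in> borel_measurable M"
  shows "measure (distr M borel Y) {x..} = tail_prob M Y x"
proof -
  interpret D: prob_space "distr M borel Y" using Y by (rule prob_space_distr)
  have "{x..} = space (distr M borel Y) - {..<x}" by auto
  then show ?thesis
    using D.prob_compl[of "{..<x}"] by (simp add: tail_prob_eq[OF Y])
qed

lemma measure_distr_atLeastLessThan:
  assumes Y: "Y \<in> borel_measurable M" and "x \<le> y"
  shows "measure (distr M borel Y) {x..<y} = tail_prob M Y x - tail_prob M Y y"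
proof -
  interpret D: prob_space "distr M borel Y" using Y by (rule prob_space_distr)
  have "{x..<y} = {..<y} - {..<x}" by auto
  then show ?thesis
    using D.finite_measure_Diff[of "{..<y}" "{..<x}"] assms(2) by (simp add: tail_prob_eq[OF Y])
qed

text \<open>The state before shock \<open>n\<close> is a function of the shocks in the block
  \<open>{1..<n}\<close>, which is independent of the block \<open>{n}\<close>.\<close>

lemma prob_survives_and_next:
  assumes ind: "indep_vars (\<lambda>_. borel) X {1..}"
    and id: "\<And>n. n \<ge> 1 \<Longrightarrow> distr M borel (X n) = distr M borel (X 1)"
    and n: "n \<ge> 1" and B: "B \<in> sets borel"
  shows "prob {\<omega> \<in> space M. survives \<gamma> \<beta> \<alpha> b c (\<lambda>i. X i \<omega>) n k l \<and> X n \<omega> \<in> B} =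
    prob {\<omega> \<in> space M. survives \<gamma> \<beta> \<alpha> b c (\<lambda>i. X i \<omega>) n k l} * measure (distr M borel (X 1)) B"
proof -
  \<comment> \<open>\<open>S\<close> and \<open>T\<close> are the two events carried over to the
    product spaces of the blocks, where independence of the restricted families applies.\<close>
  define S where "S = {x \<in> space (PiM {1..<n} (\<lambda>_. borel :: real measure)). survives \<gamma> \<beta> \<alpha> b c x n k l}"
  define T where "T = {x \<in> space (PiM {n} (\<lambda>_. borel :: real measure)). x n \<in> B}"
  let ?R = "\<lambda>A \<omega>. \<lambda>i\<in>A. X i \<omega>"
  have S: "S \<in> sets (PiM {1..<n} (\<lambda>_. borel))"
    unfolding S_def using measurable_survives[of n "\<lambda>x. x" "PiM {1..<n} (\<lambda>_. borel)"]
    by (simp add: pred_def)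
  have T: "T \<in> sets (PiM {n} (\<lambda>_. borel))"
    unfolding T_def using B by measurable
  have iv: "indep_var (PiM {1..<n} (\<lambda>_. borel)) (?R {1..<n}) (PiM {n} (\<lambda>_. borel)) (?R {n})"
    using ind n by (intro indep_var_restrict[where I="{1..}"]) auto
  have Xn: "X n \<in> borel_measurable M" using ind n by (auto simp: indep_vars_def)
  \<comment> \<open>The restricted path is \<open>undefined\<close> outside its block; by
    \<open>survives_cong\<close> this does not affect the event.\<close>
  have RS: "?R {1..<n} -` S \<inter> space M = {\<omega> \<in> space M. survives \<gamma> \<beta> \<alpha> b c (\<lambda>i. X i \<omega>) n k l}"
    unfolding S_def using survives_cong[of n "\<lambda>i\<in>{1..<n}. X i _" "\<lambda>i. X i _"]
    by (auto simp: space_PiM)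
  have RT: "?R {n} -` T \<inter> space M = X n -` B \<inter> space M"
    unfolding T_def by (auto simp: space_PiM)
  have "prob ((\<lambda>\<omega>. (?R {1..<n} \<omega>, ?R {n} \<omega>)) -` (S \<times> T) \<inter> space M) =
      prob (?R {1..<n} -` S \<inter> space M) * prob (?R {n} -` T \<inter> space M)"
    using iv S T by (rule indep_varD)
  moreover have "(\<lambda>\<omega>. (?R {1..<n} \<omega>, ?R {n} \<omega>)) -` (S \<times> T) \<inter> space M =
     (?R {1..<n} -` S \<inter> space M) \<inter> (?R {n} -` T \<inter> space M)" by auto
  moreover have "prob (X n -` B \<inter> space M) = measure (distr M borel (X 1)) B"
    using measure_distr[OF Xn, of B] B id[OF n] by simp
  ultimately show ?thesis
    unfolding RS RT by (simp add: Int_def vimage_def conj_ac cong: conj_cong)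
qed

end

theorem mainTheorem2:
  fixes M :: "'a measure"
    and X :: "nat \<Rightarrow> 'a \<Rightarrow> real"
    and \<alpha> \<beta> \<gamma> :: real
    and b c :: "nat \<Rightarrow> real"
    and k l :: nat
  assumes "prob_space M"
    and "prob_space.indep_vars M (\<lambda>_. borel) X {1..}"
    and "\<And>n. n \<ge> 1 \<Longrightarrow> distr M borel (X n) = distr M borel (X 1)"
    and "\<gamma> \<le> \<beta>" and "\<beta> \<le> \<alpha>"
    and "b 0 = 0" and "c 0 = 0" and "b 1 > 0"
    and "mono b" and "mono c"
    and "\<And>k l. threshold \<alpha> b c k l \<ge> \<beta>"
    and "tail_prob M (X 1) \<beta> > 0"
  shows "measure M {\<omega> \<in> space M.
            fatal_index \<gamma> \<beta> \<alpha> b c (\<lambda>i. X i \<omega>) \<noteq> \<infinity> \<and>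
            N_plus \<gamma> \<beta> \<alpha> b c (\<lambda>i. X i \<omega>) (the_enat (fatal_index \<gamma> \<beta> \<alpha> b c (\<lambda>i. X i \<omega>))) = k \<and>
            N_minus \<gamma> \<beta> \<alpha> b c (\<lambda>i. X i \<omega>) (the_enat (fatal_index \<gamma> \<beta> \<alpha> b c (\<lambda>i. X i \<omega>))) = l}
         = (1 - tail_prob M (X 1) \<beta> / tail_prob M (X 1) \<gamma>) ^ k
           * (\<Prod>h<l. 1 - tail_prob M (X 1) (threshold \<alpha> b c k h) / tail_prob M (X 1) \<beta>)
           * (tail_prob M (X 1) (threshold \<alpha> b c k l) / tail_prob M (X 1) \<gamma>)"
proof -
  interpret prob_space M by fact
  note ind = assms(2) and id = assms(3) and thr = assms(11)
  define D where "D = distr M borel (X 1)"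
  define T where "T = tail_prob M (X 1)"
  \<comment> \<open>The shift to \<open>Suc n\<close> makes \<open>a k l n\<close> refer to the
    state after \<open>n\<close> shocks, starting with \<open>n = 0\<close>.\<close>
  define a where "a k l n = prob {\<omega> \<in> space M. survives \<gamma> \<beta> \<alpha> b c (\<lambda>i. X i \<omega>) (Suc n) k l}" for k l n
  define \<theta> where "\<theta> = threshold \<alpha> b c"
  have Xm: "X n \<in> borel_measurable M" if "n \<ge> 1" for n
    using ind that by (auto simp: indep_vars_def)
  have T_lessThan: "measure D {..<x} = 1 - T x" for x
    using Xm by (simp add: D_def T_def tail_prob_eq)
  have T_Icc: "measure D {x..<y} = T x - T y" if "x \<le> y" for x y
    using Xm that by (simp add: D_def T_def measure_distr_atLeastLessThan)
  have T_atLeast: "measure D {x..} = T x" for x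
    using Xm by (simp add: D_def T_def measure_distr_atLeast)
  have T_mono: "T y \<le> T x" if "x \<le> y" for x y
    using T_Icc[OF that] measure_nonneg[of D "{x..<y}"] by simp
  have T\<beta>: "T \<beta> > 0" using assms(12) by (simp add: T_def)
  then have T\<gamma>: "T \<gamma> > 0" using T_mono[OF \<open>\<gamma> \<le> \<beta>\<close>] by simp
  have \<theta>: "\<beta> \<le> \<theta> k l" for k l using thr by (simp add: \<theta>_def)

  \<comment> \<open>Both the one-step transitions and the fatal events have this form: a state,
    followed by a range for the next shock.\<close>
  define E where "E n k l B = {\<omega> \<in> space M. survives \<gamma> \<beta> \<alpha> b c (\<lambda>i. X i \<omega>) (Suc n) k l \<and> X (Suc n) \<omega> \<in> B}"
    for n k l and B :: "real set"
  have E_prob: "prob (E n k l B) = a k l n * measure D B" if "B \<in> sets borel" for n k l B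
    unfolding a_def D_def E_def using that by (intro prob_survives_and_next ind id) auto
  have E_sets: "E n k l B \<in> events" if [measurable]: "B \<in> sets borel" for n k l B
  proof -
    have [measurable]: "Measurable.pred M (\<lambda>\<omega>. survives \<gamma> \<beta> \<alpha> b c (\<lambda>i. X i \<omega>) (Suc n) k l)"
      by (rule measurable_survives) (auto intro: Xm)
    have [measurable]: "X (Suc n) \<in> borel_measurable M" by (rule Xm) simp
    show ?thesis unfolding E_def by measurable
  qed
  have E_Un: "prob (E n k l B \<union> E n k' l' B') = a k l n * measure D B + a k' l' n * measure D B'"
    if "B \<in> sets borel" "B' \<in> sets borel" "B \<inter> B' = {}" for n k l B k' l' B'
  proof -
    have "E n k l B \<inter> E n k' l' B' = {}" using that(3) by (auto simp: E_def)
    then show ?thesis using that by (simp add: finite_measure_Union E_sets E_prob)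
  qed

  \<comment> \<open>Recursions in time for the state probabilities\<close>
  note step = survives_Suc[OF _ \<open>\<gamma> \<le> \<beta>\<close> thr, of "Suc n" for n]
  have a_0: "a k l 0 = of_bool (k = 0 \<and> l = 0)" for k l
    by (auto simp: a_def survives_1 prob_space)
  have rec0: "a 0 0 (Suc n) = (1 - T \<gamma>) * a 0 0 n" for n
  proof -
    have "a 0 0 (Suc n) = prob (E n 0 0 {..<\<gamma>})"
      unfolding a_def E_def by (subst step) auto
    then show ?thesis by (simp add: E_prob T_lessThan)
  qed
  have rec_plus: "a (Suc k) 0 (Suc n) = (1 - T \<gamma>) * a (Suc k) 0 n + (T \<gamma> - T \<beta>) * a k 0 n" for k n
  proof -
    have "a (Suc k) 0 (Suc n) = prob (E n (Suc k) 0 {..<\<gamma>} \<union> E n k 0 {\<gamma>..<\<beta>})"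
      unfolding a_def E_def by (subst step) (auto intro!: arg_cong[of _ _ prob])
    also have "\<dots> = a (Suc k) 0 n * measure D {..<\<gamma>} + a k 0 n * measure D {\<gamma>..<\<beta>}"
      by (rule E_Un) auto
    finally show ?thesis using \<open>\<gamma> \<le> \<beta>\<close> by (simp add: T_Icc T_lessThan)
  qed
  have rec_minus: "a k (Suc l) (Suc n) = (1 - T \<beta>) * a k (Suc l) n + (T \<beta> - T (\<theta> k l)) * a k l n" for k l n
  proof -
    have "a k (Suc l) (Suc n) = prob (E n k (Suc l) {..<\<beta>} \<union> E n k l {\<beta>..<\<theta> k l})"
      unfolding a_def E_def \<theta>_def by (subst step) (auto intro!: arg_cong[of _ _ prob])
    also have "\<dots> = a k (Suc l) n * measure D {..<\<beta>} + a k l n * measure D {\<beta>..<\<theta> k l}"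
      by (rule E_Un) auto
    finally show ?thesis using \<theta> by (simp add: T_Icc T_lessThan)
  qed
  have a_nonneg: "a k l n \<ge> 0" for k l n by (simp add: a_def)

  \<comment> \<open>Expected numbers of visits to the states\<close>
  have sums_plus: "a k 0 sums ((1 - T \<beta> / T \<gamma>) ^ k / T \<gamma>)" for k
  proof (induction k)
    case 0
    \<comment> \<open>The initial state has no inflow; its starting mass 1 yields
      \<open>1 / T \<gamma>\<close>.\<close>
    have "a 0 0 sums ((a 0 0 0 + 0) / (1 - (1 - T \<gamma>)))"
      by (rule recurrence_sums[where v="\<lambda>_. 0"]) (use a_nonneg T\<gamma> rec0 in auto)
    then show ?case by (simp add: a_0)
  next
    case (Suc k)
    \<comment> \<open>Here the inflow is \<open>T \<gamma> - T \<beta>\<close> times the visits to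
      the preceding state, known from the induction hypothesis, and the starting mass is 0.\<close>
    have "a (Suc k) 0 sums ((a (Suc k) 0 0 + (T \<gamma> - T \<beta>) * ((1 - T \<beta> / T \<gamma>) ^ k / T \<gamma>)) / (1 - (1 - T \<gamma>)))"
      by (rule recurrence_sums[OF _ _ _ _ sums_mult[OF Suc.IH]])
         (use a_nonneg T\<gamma> rec_plus T_mono[OF \<open>\<gamma> \<le> \<beta>\<close>] in auto)
    moreover have "(T \<gamma> - T \<beta>) / T \<gamma> * ((1 - T \<beta> / T \<gamma>) ^ k / T \<gamma>) = (1 - T \<beta> / T \<gamma>) ^ Suc k / T \<gamma>"
      using T\<gamma> by (simp add: diff_divide_distrib)
    ultimately show ?case
      by (simp add: a_0)
  qed
  \<comment> \<open>From here on \<open>k\<close> is fixed: weakening steps leave it unchanged, so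
    each adds one factor with threshold \<open>\<theta> k h\<close>.\<close>
  define P where "P l = (1 - T \<beta> / T \<gamma>) ^ k * (\<Prod>h<l. 1 - T (\<theta> k h) / T \<beta>)" for l
  have sums_minus: "a k l sums (P l / T \<gamma>)" for l
  proof (induction l)
    case 0
    then show ?case using sums_plus by (simp add: P_def)
  next
    case (Suc l)
    \<comment> \<open>The leaving probability is now \<open>T \<beta>\<close> rather than
      \<open>T \<gamma>\<close>, which accounts for the denominators in the product.\<close>
    have "a k (Suc l) sums ((a k (Suc l) 0 + (T \<beta> - T (\<theta> k l)) * (P l / T \<gamma>)) / (1 - (1 - T \<beta>)))"
      by (rule recurrence_sums[OF _ _ _ _ sums_mult[OF Suc.IH]])
         (use a_nonneg T\<beta> rec_minus T_mono[OF \<theta>] in auto)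
    moreover have "(T \<beta> - T (\<theta> k l)) * (P l / T \<gamma>) / T \<beta> = P (Suc l) / T \<gamma>"
      using T\<beta> T\<gamma> by (simp add: P_def field_simps)
    ultimately show ?case by (simp add: a_0)
  qed

  \<comment> \<open>Summation over the time of the fatal shock\<close>
  have "(\<lambda>n. prob (E n k l {\<theta> k l..})) sums prob (\<Union>n. E n k l {\<theta> k l..})"
  proof (rule finite_measure_UNION)
    show "range (\<lambda>n. E n k l {\<theta> k l..}) \<subseteq> events" using E_sets by auto
    show "disjoint_family (\<lambda>n. E n k l {\<theta> k l..})"
      unfolding disjoint_family_on_def E_def \<theta>_def by (blast dest: survives_unique)
  qed
  \<comment> \<open>Independence takes the fatal probability \<open>T (\<theta> k l)\<close> out of
    the series, leaving the expected number of visits.\<close>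
  moreover have "(\<lambda>n. prob (E n k l {\<theta> k l..})) sums (P l / T \<gamma> * T (\<theta> k l))"
    using sums_mult2[OF sums_minus] by (simp add: E_prob T_atLeast)
  ultimately have "prob (\<Union>n. E n k l {\<theta> k l..}) = P l * (T (\<theta> k l) / T \<gamma>)"
    by (simp add: sums_unique2)
  also have "(\<Union>n. E n k l {\<theta> k l..}) = {\<omega> \<in> space M.
      \<exists>n. survives \<gamma> \<beta> \<alpha> b c (\<lambda>i. X i \<omega>) (Suc n) k l \<and> X (Suc n) \<omega> \<in> {threshold \<alpha> b c k l..}}"
    by (auto simp: E_def \<theta>_def)
  finally show ?thesis
    unfolding fatal_state_iff by (simp add: P_def T_def \<theta>_def)
qed

end
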